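(* The induced $a$-path on $4$ vertices is a consistent atomic $17_{37}$-network which is unsatisfiable.
   Context: A relation algebra is an algebra $\mathbf{A}=(A;\cup,\bar{\ },0,1,\mathrm{Id},\breve{\ },\circ)$ such that, with $x\cap y:=\overline{(\bar x\cup\bar y)}$, the structure $(A;\cup,\cap,\bar{\ },0,1)$ is a Boolean algebra, $\circ$ is associative, and for all $a,b,c\in A$: $(a\cup b)\circ c=(a\circ c)\cup(b\circ c)$; $a\circ\mathrm{Id}=a$; $\breve{\breve a}=a$; $(a\cup b)\breve{\ }=\breve a\cup\breve b$; $(a\circ b)\breve{\ }=\breve b\circ\breve a$; $\bar b\cup(\breve a\circ\overline{(a\circ b)})=\bar b$. Write $a\le b$ if $a\cap b=a$. An atom is a minimal element of $A\setminus\{0\}$ with respect to $\le$. In a finite relation algebra, $\circ$ and $\breve{\ }$ are determined by their values on atoms. $17_{37}$ is the finite relation algebra with exactly four atoms $\mathrm{Id},a,r,\breve r$, where $\breve a=a$, $\breve r\neq r$, $\mathrm{Id}\circ x=x\circ\mathrm{Id}=x$, where for $x,y\in\{a,r,\breve r\}$ we have $\mathrm{Id}\le x\circ y$ iff $y=\breve x$, and where for $x,y,z\in\{a,r,\breve r\}$ we have $z\le x\circ y$ iff $(x,y,z)\notin\{(r,r,a),(\breve r,a,r),(a,\breve r,r),(a,r,\breve r),(r,a,\breve r),(\breve r,\breve r,a)\}$. A representation of $\mathbf{A}$ is a relational structure $\mathfrak{B}$ with domain $B$ and a binary relation $a^{\mathfrak{B}}\subseteq B^2$ for each $a\in A$ such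 that for all $a,b\in A$: $0^{\mathfrak{B}}=\varnothing$; $1^{\mathfrak{B}}=\bigcup_{a\in A}a^{\mathfrak{B}}$; $\mathrm{Id}^{\mathfrak{B}}=\{(u,u)\mid u\in B\}$; $(\bar a)^{\mathfrak{B}}=1^{\mathfrak{B}}\setminus a^{\mathfrak{B}}$; $(\breve a)^{\mathfrak{B}}=\{(u,v)\mid(v,u)\in a^{\mathfrak{B}}\}$; $(a\cup b)^{\mathfrak{B}}=a^{\mathfrak{B}}\cup b^{\mathfrak{B}}$; $(a\circ b)^{\mathfrak{B}}=a^{\mathfrak{B}}\circ b^{\mathfrak{B}}$ (the usual composition of binary relations). An $\mathbf{A}$-network $(V,f)$ is a finite set $V$ together with a function $f\colon V^2\to A$. It is atomic if every $f(x,y)$ is an atom, and consistent if $f(x,x)\le\mathrm{Id}$ and $f(x,y)\le f(x,z)\circ f(z,y)$ for all $x,y,z\in V$. It is satisfiable if there are a representation $\mathfrak{B}$ of $\mathbf{A}$ and a map $s\colon V\to B$ with $(s(x),s(y))\in f(x,y)^{\mathfrak{B}}$ for all $x,y\in V$, and unsatisfiable otherwise. The induced $a$-path on $4$ vertices is the $17_{37}$-network $(P,f_P)$ with $P=\{0,1,2,3\}$, $f_P(0,1)=f_P(1,2)=f_P(2,3)=a$, $f_P(0,2)=f_P(0,3)=f_P(1,3)=r$, $f_P(i,i)=\mathrm{Id}$, and $f_P(j,i)=(f_P(i,j))\breve{\ }$ for $i<j$. *)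

theory Defs
  imports "HOL-Library.FuncSet"
begin

text \<open>The underlying set of a relation algebra is the whole type \<open>'a\<close>.\<close>

record 'a relalg =
  join :: "'a \<Rightarrow> 'a \<Rightarrow> 'a"  (infixl "\<squnion>\<index>" 65)
  compl :: "'a \<Rightarrow> 'a"
  zero :: 'a
  one :: 'a
  ident :: 'a
  conv :: "'a \<Rightarrow> 'a"
  comp :: "'a \<Rightarrow> 'a \<Rightarrow> 'a"  (infixl "\<odot>\<index>" 75)

definition meet :: "'a relalg \<Rightarrow> 'a \<Rightarrow> 'a \<Rightarrow> 'a" where
  "meet A x y = compl A (join A (compl A x) (compl A y))"

definition below :: "'a relalg \<Rightarrow> 'a \<Rightarrow> 'a \<Rightarrow> bool" where
  "below A x y \<longleftrightarrow> meet A x y = x"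

definition is_atom :: "'a relalg \<Rightarrow> 'a \<Rightarrow> bool" where
  "is_atom A x \<longleftrightarrow> x \<noteq> zero A \<and> (\<forall>y. y \<noteq> zero A \<and> below A y x \<longrightarrow> y = x)"

locale relation_algebra =
  abstract_boolean_algebra "meet A" "join A" "compl A" "zero A" "one A"
  for A :: "'a relalg" (structure) +
  assumes comp_assoc: "(a \<odot> b) \<odot> c = a \<odot> (b \<odot> c)"
    and comp_join_distrib: "(a \<squnion> b) \<odot> c = (a \<odot> c) \<squnion> (b \<odot> c)"
    and comp_ident: "a \<odot> ident A = a"
    and conv_conv: "conv A (conv A a) = a"
    and conv_join: "conv A (a \<squnion> b) = conv A a \<squnion> conv A b"
    and conv_comp: "conv A (a \<odot> b) = conv A b \<odot> conv A a"
    and tarski: "compl A b \<squnion> (conv A a \<odot> compl A (a \<odot> b)) = compl A b"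

text \<open>A representation is given by its domain \<open>B\<close> and the interpretation \<open>\<rho>\<close> of the elements
  of the algebra; \<open>\<rho> (one A)\<close> need not be all of \<open>B \<times> B\<close>.\<close>

definition representation ::
    "'a relalg \<Rightarrow> 'b set \<Rightarrow> ('a \<Rightarrow> ('b \<times> 'b) set) \<Rightarrow> bool" where
  "representation A B \<rho> \<longleftrightarrow>
     (\<forall>a. \<rho> a \<subseteq> B \<times> B) \<and>
     \<rho> (zero A) = {} \<and>
     \<rho> (one A) = (\<Union>a. \<rho> a) \<and>
     \<rho> (ident A) = {(u, u) |u. u \<in> B} \<and>
     (\<forall>a. \<rho> (compl A a) = \<rho> (one A) - \<rho> a) \<and>
     (\<forall>a. \<rho> (conv A a) = {(u, v). (v, u) \<in> \<rho> a}) \<and>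
     (\<forall>a b. \<rho> (join A a b) = \<rho> a \<union> \<rho> b) \<and>
     (\<forall>a b. \<rho> (comp A a b) = \<rho> a O \<rho> b)"

text \<open>Only the values of \<open>f\<close> on \<open>V \<times> V\<close> matter; its values lie in the algebra by typing.\<close>

definition network :: "'a relalg \<Rightarrow> 'v set \<Rightarrow> ('v \<times> 'v \<Rightarrow> 'a) \<Rightarrow> bool" where
  "network A V f \<longleftrightarrow> relation_algebra A \<and> finite V \<and> f \<in> V \<times> V \<rightarrow> UNIV"

definition atomic :: "'a relalg \<Rightarrow> 'v set \<Rightarrow> ('v \<times> 'v \<Rightarrow> 'a) \<Rightarrow> bool" where
  "atomic A V f \<longleftrightarrow> (\<forall>x\<in>V. \<forall>y\<in>V. is_atom A (f (x, y)))"

definition consistent :: "'a relalg \<Rightarrow> 'v set \<Rightarrow> ('v \<times> 'v \<Rightarrow> 'a) \<Rightarrow> bool" where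
  "consistent A V f \<longleftrightarrow>
     (\<forall>x\<in>V. below A (f (x, x)) (ident A)) \<and>
     (\<forall>x\<in>V. \<forall>y\<in>V. \<forall>z\<in>V. below A (f (x, y)) (comp A (f (x, z)) (f (z, y))))"

text \<open>HOL cannot quantify over types inside a formula, so the type \<open>'b\<close> in which the domains
  of the representations live is a parameter. Unsatisfiability is the negation of this predicate
  for a free, hence universally quantified, \<open>'b\<close>.\<close>

definition satisfiable ::
    "'b itself \<Rightarrow> 'a relalg \<Rightarrow> 'v set \<Rightarrow> ('v \<times> 'v \<Rightarrow> 'a) \<Rightarrow> bool" where
  "satisfiable (_ :: 'b itself) A V f \<longleftrightarrow>
     (\<exists>(B :: 'b set) \<rho> s. representation A B \<rho> \<and> s \<in> V \<rightarrow> B \<and>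
        (\<forall>x\<in>V. \<forall>y\<in>V. (s x, s y) \<in> \<rho> (f (x, y))))"

text \<open>The algebra \<open>17\<^sub>3\<^sub>7\<close> is realised on the powerset of its set of atoms; \<open>AtRc\<close> is the converse
  of \<open>AtR\<close>.\<close>

datatype atom = AtId | AtA | AtR | AtRc

fun atom_conv :: "atom \<Rightarrow> atom" where
  "atom_conv AtId = AtId"
| "atom_conv AtA = AtA"
| "atom_conv AtR = AtRc"
| "atom_conv AtRc = AtR"

definition atom_comp :: "atom \<Rightarrow> atom \<Rightarrow> atom set" where
  "atom_comp x y =
     (if x = AtId then {y}
      else if y = AtId then {x}
      else {z. if z = AtId then y = atom_conv x
               else (x, y, z) \<notin> {(AtR, AtR, AtA), (AtRc, AtA, AtR), (AtA, AtRc, AtR),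
                                 (AtA, AtR, AtRc), (AtR, AtA, AtRc), (AtRc, AtRc, AtA)}})"

definition ra17_37 :: "atom set relalg" where
  "ra17_37 = \<lparr> join = (\<union>), compl = uminus, zero = {}, one = UNIV, ident = {AtId},
     conv = (\<lambda>X. atom_conv ` X), comp = (\<lambda>X Y. \<Union>x\<in>X. \<Union>y\<in>Y. atom_comp x y) \<rparr>"

lemma meet_ra17_37: "meet ra17_37 X Y = X \<inter> Y"
  by (auto simp: meet_def ra17_37_def)

lemma below_ra17_37: "below ra17_37 X Y \<longleftrightarrow> X \<subseteq> Y"
  by (auto simp: below_def meet_ra17_37)

lemma is_atom_ra17_37: "is_atom ra17_37 X \<longleftrightarrow> X \<in> {{AtId}, {AtA}, {AtR}, {AtRc}}"
proof -
  have "is_atom ra17_37 X \<longleftrightarrow> (\<exists>x. X = {x})"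
    unfolding is_atom_def below_ra17_37 by (auto simp: ra17_37_def)
  also have "\<dots> \<longleftrightarrow> X \<in> {{AtId}, {AtA}, {AtR}, {AtRc}}"
    by (auto intro: atom.exhaust)
  finally show ?thesis .
qed

lemma atom_conv_atom_conv: "atom_conv (atom_conv x) = x"
  by (cases x) auto

lemma atom_comp_assoc:
  "(\<exists>u. u \<in> atom_comp x y \<and> w \<in> atom_comp u z) \<longleftrightarrow> (\<exists>v. v \<in> atom_comp y z \<and> w \<in> atom_comp x v)"
proof -
  have ex: "(\<exists>u. P u) \<longleftrightarrow> P AtId \<or> P AtA \<or> P AtR \<or> P AtRc" for P
    by (auto; case_tac u; simp)
  show ?thesis
    by (cases x; cases y; cases z; cases w; simp add: ex atom_comp_def)
qed

lemma atom_comp_ident: "atom_comp x AtId = {x}"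
  by (simp add: atom_comp_def)

lemma atom_comp_conv:
  "w \<in> atom_comp (atom_conv y) (atom_conv x) \<longleftrightarrow> atom_conv w \<in> atom_comp x y"
  by (cases x; cases y; cases w; simp add: atom_comp_def)

lemma atom_comp_rotate: "z \<in> atom_comp (atom_conv x) y \<longleftrightarrow> y \<in> atom_comp x z"
  by (cases x; cases y; cases z; simp add: atom_comp_def)

lemma relation_algebra_ra17_37: "relation_algebra ra17_37"
proof
  fix X Y Z :: "atom set"
  show "comp ra17_37 (comp ra17_37 X Y) Z = comp ra17_37 X (comp ra17_37 Y Z)"
  proof (rule set_eqI)
    fix w
    have "w \<in> comp ra17_37 (comp ra17_37 X Y) Z \<longleftrightarrow>
        (\<exists>x\<in>X. \<exists>y\<in>Y. \<exists>z\<in>Z. \<exists>u. u \<in> atom_comp x y \<and> w \<in> atom_comp u z)"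
      by (auto simp: ra17_37_def)
    also have "\<dots> \<longleftrightarrow> (\<exists>x\<in>X. \<exists>y\<in>Y. \<exists>z\<in>Z. \<exists>v. v \<in> atom_comp y z \<and> w \<in> atom_comp x v)"
      by (simp only: atom_comp_assoc)
    also have "\<dots> \<longleftrightarrow> w \<in> comp ra17_37 X (comp ra17_37 Y Z)"
      by (auto simp: ra17_37_def)
    finally show "w \<in> comp ra17_37 (comp ra17_37 X Y) Z \<longleftrightarrow>
        w \<in> comp ra17_37 X (comp ra17_37 Y Z)" .
  qed
  show "comp ra17_37 X (ident ra17_37) = X"
    by (auto simp: ra17_37_def atom_comp_ident)
  show "conv ra17_37 (conv ra17_37 X) = X"
    by (simp add: ra17_37_def image_image atom_conv_atom_conv)
  show "conv ra17_37 (comp ra17_37 X Y) = comp ra17_37 (conv ra17_37 Y) (conv ra17_37 X)"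
  proof (rule set_eqI)
    fix w
    have "w \<in> atom_conv ` S \<longleftrightarrow> atom_conv w \<in> S" for S
      by (metis atom_conv_atom_conv image_iff)
    then show "w \<in> conv ra17_37 (comp ra17_37 X Y) \<longleftrightarrow>
        w \<in> comp ra17_37 (conv ra17_37 Y) (conv ra17_37 X)"
      by (auto simp: ra17_37_def atom_comp_conv)
  qed
  show "join ra17_37 (compl ra17_37 Y)
      (comp ra17_37 (conv ra17_37 X) (compl ra17_37 (comp ra17_37 X Y))) = compl ra17_37 Y"
    by (auto simp: ra17_37_def atom_comp_rotate)
qed (auto simp: meet_ra17_37, auto simp: ra17_37_def)

definition P_vertices :: "nat set" where
  "P_vertices = {0, 1, 2, 3}"

definition f_P :: "nat \<times> nat \<Rightarrow> atom set" where
  "f_P = (\<lambda>(i, j).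
     let up = (\<lambda>i j. if (i, j) \<in> {(0, 1), (1, 2), (2, 3)} then {AtA} else {AtR}) in
     if i = j then ident ra17_37
     else if i < j then up i j
     else conv ra17_37 (up j i))"

end

theory Submission
  imports Defs
begin

text \<open>Write \<open>u \<rightarrow> v\<close> for an \<open>r\<close>-edge and \<open>r'\<close> for the converse of \<open>r\<close>. Since \<open>r \<le> r' \<circ> r'\<close>, a
  representation that realises the path contains a point \<open>z\<close> closing the cycle \<open>0 \<rightarrow> 3 \<rightarrow> z \<rightarrow> 0\<close>.
  The only forbidden triangle, \<open>u \<rightarrow> v \<rightarrow> w\<close> with an \<open>a\<close>-edge between \<open>u\<close> and \<open>w\<close>, forces
  \<open>z \<rightarrow> 1\<close> (via \<open>0\<close> and \<open>3\<close>) and \<open>2 \<rightarrow> z\<close> (via \<open>3\<close> and \<open>0\<close>). But then \<open>2 \<rightarrow> z \<rightarrow> 1\<close> is itself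
  forbidden by the \<open>a\<close>-edge between \<open>1\<close> and \<open>2\<close>.\<close>

text \<open>Complements are taken relative to \<open>\<rho> (one A)\<close>, which contains every
  \<open>\<rho> x\<close>; so De Morgan's law turns meets into intersections.\<close>

lemma representation_meet:
  assumes "representation A B \<rho>"
  shows "\<rho> (meet A x y) = \<rho> x \<inter> \<rho> y"
proof -
  have compl: "\<rho> (compl A x) = \<rho> (one A) - \<rho> x" for x
    using assms by (simp add: representation_def)
  have join: "\<rho> (join A x y) = \<rho> x \<union> \<rho> y" for x y
    using assms by (simp add: representation_def)
  have "\<rho> (one A) = (\<Union>x. \<rho> x)"
    using assms by (simp add: representation_def)
  then have "\<rho> x \<subseteq> \<rho> (one A)"
    by blast
  then show ?thesis
    unfolding meet_def compl join by blast
qed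

lemma representation_comp:
  assumes "representation A B \<rho>" "(u, v) \<in> \<rho> x" "(v, w) \<in> \<rho> y"
  shows "(u, w) \<in> \<rho> (comp A x y)"
proof -
  have "\<rho> (comp A x y) = \<rho> x O \<rho> y"
    using assms(1) by (simp add: representation_def)
  with assms(2,3) show ?thesis by blast
qed

lemma comp_singletons_ra17_37: "comp ra17_37 {x} {y} = atom_comp x y"
  by (simp add: ra17_37_def)

lemma atom_comp_values:
  "atom_comp AtA AtRc = {AtA, AtRc}"
  "atom_comp AtRc AtA = {AtA, AtRc}"
  "atom_comp AtR AtR = {AtR, AtRc}"
  "atom_comp AtRc AtRc = {AtR, AtRc}"
  by (rule set_eqI, case_tac x, simp_all add: atom_comp_def)+

lemma f_P_values:
  "f_P (0, 3) = {AtR}" "f_P (0, 2) = {AtR}" "f_P (1, 3) = {AtR}"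
  "f_P (1, 0) = {AtA}" "f_P (1, 2) = {AtA}" "f_P (3, 2) = {AtA}"
  by (auto simp: f_P_def ra17_37_def)

lemma atomic_f_P: "atomic ra17_37 P_vertices f_P"
  unfolding atomic_def is_atom_ra17_37
  by (auto simp: P_vertices_def f_P_def ra17_37_def)

lemma consistent_f_P: "consistent ra17_37 P_vertices f_P"
  unfolding consistent_def below_ra17_37
  by (simp add: P_vertices_def f_P_def ra17_37_def atom_comp_def)

lemma unsatisfiable_f_P: "\<not> satisfiable TYPE('b) ra17_37 P_vertices f_P"
proof
  assume "satisfiable TYPE('b) ra17_37 P_vertices f_P"
  then obtain B :: "'b set" and \<rho> s where rep: "representation ra17_37 B \<rho>"
    and s: "\<And>x y. x \<in> P_vertices \<Longrightarrow> y \<in> P_vertices \<Longrightarrow> (s x, s y) \<in> \<rho> (f_P (x, y))"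
    unfolding satisfiable_def by blast
  have edges: "(s 0, s 3) \<in> \<rho> {AtR}" "(s 0, s 2) \<in> \<rho> {AtR}" "(s 1, s 3) \<in> \<rho> {AtR}"
    "(s 1, s 0) \<in> \<rho> {AtA}" "(s 1, s 2) \<in> \<rho> {AtA}" "(s 3, s 2) \<in> \<rho> {AtA}"
    using s[of 0 3] s[of 0 2] s[of 1 3] s[of 1 0] s[of 1 2] s[of 3 2]
    by (simp_all add: f_P_values P_vertices_def del: One_nat_def)
  have meet: "p \<in> \<rho> (X \<inter> Y)" if "p \<in> \<rho> X" "p \<in> \<rho> Y" for p X Y
    using that representation_meet[OF rep, of X Y] by (simp add: meet_ra17_37)
  have comp: "(u, w) \<in> \<rho> (atom_comp x y)" if "(u, v) \<in> \<rho> {x}" "(v, w) \<in> \<rho> {y}" for u v w x y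
    using representation_comp[OF rep that] by (simp add: comp_singletons_ra17_37)
  have empty: "\<rho> {} = {}"
    using rep by (simp add: representation_def ra17_37_def)
  have "\<rho> (join ra17_37 {AtR} {AtRc}) = \<rho> {AtR} \<union> \<rho> {AtRc}"
    using rep by (simp add: representation_def)
  then have join: "\<rho> {AtR, AtRc} = \<rho> {AtR} \<union> \<rho> {AtRc}"
    by (simp add: ra17_37_def insert_commute)
  \<comment> \<open>The pair \<open>(s 0, s 3)\<close> lies in the left-hand side, so the equality
    yields the intermediate point \<open>z\<close>.\<close>
  have "\<rho> {AtR, AtRc} = \<rho> {AtRc} O \<rho> {AtRc}"
    unfolding atom_comp_values(4)[symmetric] comp_singletons_ra17_37[symmetric]
    using rep by (simp add: representation_def)
  with join edges obtain z where z: "(s 0, z) \<in> \<rho> {AtRc}" "(z, s 3) \<in> \<rho> {AtRc}"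
    by blast
  have conv: "(v, u) \<in> \<rho> {AtR}" if "(u, v) \<in> \<rho> {AtRc}" for u v
  proof -
    have "\<rho> (conv ra17_37 {AtRc}) = {(u, v). (v, u) \<in> \<rho> {AtRc}}"
      using rep by (simp add: representation_def)
    with that show ?thesis by (simp add: ra17_37_def)
  qed
  \<comment> \<open>The route through \<open>s 0\<close> rules out \<open>AtR\<close>, the one
    through \<open>s 3\<close> rules out \<open>AtA\<close>; only \<open>AtRc\<close>
    remains.\<close>
  have "(s 1, z) \<in> \<rho> ({AtA, AtRc} \<inter> {AtR, AtRc})"
    using comp[OF edges(4) z(1)] comp[OF edges(3) conv[OF z(2)]]
    unfolding atom_comp_values by (rule meet)
  \<comment> \<open>Here \<open>s 3\<close> rules out \<open>AtR\<close> and \<open>s 0\<close>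
    rules out \<open>AtA\<close>.\<close>
  moreover have "(z, s 2) \<in> \<rho> ({AtA, AtRc} \<inter> {AtR, AtRc})"
    using comp[OF z(2) edges(6)] comp[OF conv[OF z(1)] edges(2)]
    unfolding atom_comp_values by (rule meet)
  ultimately have "(s 1, s 2) \<in> \<rho> {AtR, AtRc}"
    using comp[of "s 1" z AtRc "s 2" AtRc] by (simp add: atom_comp_values)
  then have "(s 1, s 2) \<in> \<rho> ({AtA} \<inter> {AtR, AtRc})"
    using meet edges(5) by blast
  then show False
    by (simp add: empty)
qed

theorem lemma4p18:
  shows "network ra17_37 P_vertices f_P \<and>
    atomic ra17_37 P_vertices f_P \<and>
    consistent ra17_37 P_vertices f_P \<and>
    \<not> satisfiable TYPE('b) ra17_37 P_vertices f_P"
proof -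
  have "network ra17_37 P_vertices f_P"
    using relation_algebra_ra17_37 by (simp add: network_def P_vertices_def)
  then show ?thesis
    using atomic_f_P consistent_f_P unsatisfiable_f_P by blast
qed

end
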